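(* Let $p,\lambda,p_r,\theta,K,c,c_d,c_p,c_s,h_s,h_r$ be positive real constants, let $\alpha\in(0,1)$, $\gamma,\alpha_r\in(0,1]$, and assume $\alpha p>\lambda$. Put $$\eta=\frac{(1-\alpha)\lambda}{\alpha p_r+(1-\alpha)\alpha_r p_r},$$ $$A=h_s\left[\frac{(\alpha_r p_r-\lambda)^2\eta^2}{2(\alpha p-\lambda)}-\frac{(\alpha_r p_r-\lambda)\eta^2}{2}\right]+h_r\left[\frac{(p_r^2+(1-\alpha)p\,p_r)\eta^2}{2(1-\alpha)p}\right]+c_s\left[\frac{\lambda\big((1-\eta)(\alpha p-\lambda)+\eta(\alpha_r p_r-\lambda)\big)^2}{2\alpha p(\alpha p-\lambda)}\right],$$ $$B=h_s\left[\lambda\eta-\frac{(\alpha_r p_r-\lambda)\lambda\eta}{\alpha p-\lambda}\right]-c_s\left[\frac{\lambda\big((1-\eta)(\alpha p-\lambda)+\eta(\alpha_r p_r-\lambda)\big)}{\alpha p-\lambda}\right],$$ $$C=\big(\gamma c+(1-\gamma)c_d\big)\frac{\lambda\theta}{2}+h_s\left[\frac{\lambda^2}{2(\alpha p-\lambda)}+\frac{\lambda}{2}\right]+c_s\,\frac{\alpha p\lambda}{2(\alpha p-\lambda)},$$ $$D=c_p(1-\alpha_r)p_r\eta,$$ and define, for $T_4>0$ and $T>0$, $$TC(T_4,T)=AT+BT_4+C\frac{T_4^2}{T}+\frac{K}{T}+D.$$ Then $TC$ is strictly convex on $\{(T_4,T): T_4>0,\ T>0\}$. Moreover, if $$B<0\quad\text{and}\quad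 4AC>B^2,$$ then an optimal pair (a minimizer of $TC$ over $T_4>0$, $T>0$) exists and is given by $$(T_4^*,T^* )=\left(-B\sqrt{\frac{K}{C(4AC-B^2)}},\ 2\sqrt{\frac{CK}{4AC-B^2}}\right).$$
   Context: The function $TC(T_4,T)$ is the (approximated) total cost per unit time of a single production plant with rework, deteriorating items and completely backlogged shortages. $T$ is the cycle length and $T_4$ is the length of the period in which the stock of serviceable items is depleted after rework ends. The parameters are: $p$ production rate, $\alpha$ fraction of good quality items produced, $\lambda$ demand rate, $\theta$ fraction of items deteriorating per unit time, $\gamma$ fraction of deteriorated items screened out, $p_r$ rework rate, $\alpha_r$ fraction of imperfect quality items recovered by rework, $K$ setup cost per cycle, $c$ deterioration cost, $c_d$ penalty cost for selling deteriorated items, $c_p$ cost of unrecoverable items, $c_s$ shortage cost, $h_s$ and $h_r$ holding costs of serviceable and imperfect quality items. "Optimal pair" means a pair $(T_4^*,T^* )$ with $T_4^*>0$, $T^*>0$ at which $TC$ attains its minimum over all $T_4>0$, $T>0$. *)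

theory Defs
  imports "HOL-Analysis.Analysis"
begin

text \<open>The strict counterpart of \<^const>\<open>convex_on\<close>, which the library does not provide.\<close>

definition strictly_convex_on :: "'a::real_vector set \<Rightarrow> ('a \<Rightarrow> real) \<Rightarrow> bool"
  where "strictly_convex_on S f \<longleftrightarrow> convex S \<and>
    (\<forall>x\<in>S. \<forall>y\<in>S. \<forall>u>0. \<forall>v>0. x \<noteq> y \<longrightarrow> u + v = 1 \<longrightarrow>
      f (u *\<^sub>R x + v *\<^sub>R y) < u * f x + v * f y)"

definition optimal_pair :: "(real \<times> real \<Rightarrow> real) \<Rightarrow> real \<times> real \<Rightarrow> bool"
  where "optimal_pair F z \<longleftrightarrow> is_arg_min F (\<lambda>(T4, T). T4 > 0 \<and> T > 0) z"

end

theory Submission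
  imports Defs
begin

text \<open>
  The argument treats \<open>A\<close>, \<open>B\<close>, \<open>C\<close>, \<open>D\<close>, \<open>K\<close> as plain constants.  All that it takes from the
  production model is \<open>K > 0\<close> and \<open>C > 0\<close>, the latter because \<open>\<alpha> p > \<lambda>\<close> makes every summand of
  \<open>C\<close> positive.

  Up to an affine function, \<open>TC\<close> is \<open>C T\<^sub>4\<^sup>2 / T + K / T\<close>.  The first term is homogeneous of
  degree one, hence convex but linear along rays; the term \<open>K / T\<close> is strictly convex in \<open>T\<close>,
  which supplies the strictness along rays.  Accordingly the convexity gap between two points is a
  combination of two squares with positive weights, one vanishing only for points on a common ray
  and the other only for equal \<open>T\<close>, so both vanish only when the points coincide
  (\<open>square_over_linear_convexity_gap\<close>, applied once to \<open>T\<^sub>4\<^sup>2 / T\<close> and once to \<open>1 / T\<close>).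

  The minimum is found by completing the square twice (\<open>cost_complete_squares\<close>).  For fixed
  \<open>T\<close> the best \<open>T\<^sub>4\<close> is \<open>-B T / (2C)\<close>; what then remains is, with \<open>E = 4AC - B\<^sup>2\<close>, the function
  \<open>(E / (4C)) T + K / T\<close> of economic-order-quantity type, whose minimum is at \<open>T\<^sup>2 = 4CK / E\<close>.
  The condition \<open>E > 0\<close> makes this stationary point real, and \<open>B < 0\<close> puts \<open>T\<^sub>4\<close> in the
  positive quadrant.
\<close>

section \<open>Strict convexity\<close>

text \<open>
  This identity is what makes \<open>x\<^sup>2 / t\<close> jointly convex: its convexity gap is a square, up to a
  positive factor, that vanishes exactly for two points on a common ray from the origin.
\<close>

lemma square_over_linear_convexity_gap:
  fixes x y s t u v :: real
  assumes "s > 0" "t > 0" "u > 0" "v > 0"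
  shows "u * (x\<^sup>2 / s) + v * (y\<^sup>2 / t) - (u * x + v * y)\<^sup>2 / (u * s + v * t)
    = u * v * (x * t - y * s)\<^sup>2 / (s * t * (u * s + v * t))"
proof -
  have "u * s + v * t > 0"
    using assms by (simp add: add_pos_pos)
  then show ?thesis
    using assms by (simp add: divide_simps) (simp add: algebra_simps power2_eq_square)
qed

lemma strictly_convex_on_positive_quadrant_cost:
  fixes A B C D K :: real and F :: "real \<times> real \<Rightarrow> real"
  assumes "C > 0" "K > 0"
    and F: "\<And>x t. x > 0 \<Longrightarrow> t > 0 \<Longrightarrow> F (x, t) = A * t + B * x + C * (x\<^sup>2 / t) + K / t + D"
  shows "strictly_convex_on {(x, t). x > 0 \<and> t > 0} F"
  unfolding strictly_convex_on_def
proof (intro conjI ballI allI impI)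
  have "{(x, t). x > 0 \<and> t > 0} = {0::real<..} \<times> {0::real<..}"
    by auto
  then show "convex {(x::real, t::real). x > 0 \<and> t > 0}"
    by (simp add: convex_Times)
next
  fix z w :: "real \<times> real" and u v :: real
  assume zw: "z \<in> {(x, t). x > 0 \<and> t > 0}" "w \<in> {(x, t). x > 0 \<and> t > 0}"
    and u: "u > 0" and v: "v > 0" and "z \<noteq> w" and uv: "u + v = 1"
  obtain x s y t where zw_eq: "z = (x, s)" "w = (y, t)"
    by (metis surj_pair)
  with zw have pos: "x > 0" "s > 0" "y > 0" "t > 0"
    by auto
  define m where "m = u * s + v * t"
  have m: "m > 0"
    using pos u v by (simp add: m_def add_pos_pos)
  have mix: "u * x + v * y > 0"
    using pos u v by (simp add: add_pos_pos)
  have quadratic: "u * (x\<^sup>2 / s) + v * (y\<^sup>2 / t) - (u * x + v * y)\<^sup>2 / m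
      = u * v / (s * t * m) * (x * t - y * s)\<^sup>2"
    using square_over_linear_convexity_gap[OF pos(2,4) u v, of x y] by (simp add: m_def)
  have reciprocal: "u / s + v / t - 1 / m = u * v / (s * t * m) * (t - s)\<^sup>2"
    using square_over_linear_convexity_gap[OF pos(2,4) u v, of 1 1] uv by (simp add: m_def)
  have "u * F z + v * F w - F (u *\<^sub>R z + v *\<^sub>R w)
      = C * (u * (x\<^sup>2 / s) + v * (y\<^sup>2 / t) - (u * x + v * y)\<^sup>2 / m)
        + K * (u / s + v / t - 1 / m) + D * (u + v - 1)"
    using pos m mix by (simp add: zw_eq F m_def algebra_simps)
  also have "\<dots> = u * v / (s * t * m) * (C * (x * t - y * s)\<^sup>2 + K * (t - s)\<^sup>2)"
    unfolding quadratic reciprocal using uv by (simp add: algebra_simps)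
  also have "\<dots> > 0"
  proof -
    have "x * t - y * s \<noteq> 0 \<or> t - s \<noteq> 0"
      using \<open>z \<noteq> w\<close> pos by (auto simp: zw_eq)
    then have "C * (x * t - y * s)\<^sup>2 + K * (t - s)\<^sup>2 > 0"
      using \<open>C > 0\<close> \<open>K > 0\<close> by (auto intro: add_pos_nonneg add_nonneg_pos)
    then show ?thesis
      using u v pos m by simp
  qed
  finally show "F (u *\<^sub>R z + v *\<^sub>R w) < u * F z + v * F w"
    by simp
qed

section \<open>The minimizer\<close>

text \<open>
  The excess of the cost over its value at the claimed optimum, as a sum of two squares.  The period
  \<open>r\<close> is characterized by its square, which balances \<open>(E / (4C)) t\<close> against \<open>K / t\<close> and makes
  \<open>E r / (2C)\<close> the minimum of their sum.
\<close>

lemma cost_complete_squares: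
  fixes A B C D K r t x :: real
  assumes "C > 0" "t > 0" and r: "(4 * A * C - B\<^sup>2) * r\<^sup>2 = 4 * C * K"
  shows "A * t + B * x + C * (x\<^sup>2 / t) + K / t + D
    = C / t * (x + B * t / (2 * C))\<^sup>2 + (4 * A * C - B\<^sup>2) / (4 * C * t) * (t - r)\<^sup>2
      + ((4 * A * C - B\<^sup>2) * r / (2 * C) + D)"
proof -
  have K: "K = (4 * A * C - B\<^sup>2) * r\<^sup>2 / (4 * C)"
    using r \<open>C > 0\<close> by (simp add: field_simps)
  show ?thesis
    unfolding K using assms(1,2) by (simp add: field_simps power2_eq_square)
qed

lemma is_arg_min_iff_of_attained_bound:
  fixes f :: "'a \<Rightarrow> 'b::linorder"
  assumes "P a" and "\<And>z. P z \<Longrightarrow> f a \<le> f z" and "\<And>z. P z \<Longrightarrow> f z = f a \<Longrightarrow> z = a"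
  shows "is_arg_min f P z \<longleftrightarrow> z = a"
  using assms unfolding is_arg_min_def by (metis leD order_le_imp_less_or_eq)

lemma optimal_pair_cost_iff:
  fixes A B C D K :: real and F :: "real \<times> real \<Rightarrow> real"
  assumes "C > 0" "K > 0" "B < 0" and discr: "4 * A * C > B\<^sup>2"
    and F: "\<And>x t. x > 0 \<Longrightarrow> t > 0 \<Longrightarrow> F (x, t) = A * t + B * x + C * (x\<^sup>2 / t) + K / t + D"
  shows "optimal_pair F z \<longleftrightarrow>
    z = (- B * sqrt (K / (C * (4 * A * C - B\<^sup>2))), 2 * sqrt (C * K / (4 * A * C - B\<^sup>2)))"
proof -
  define E where "E = 4 * A * C - B\<^sup>2"
  define r where "r = 2 * sqrt (C * K / E)"
  define q where "q = - B * sqrt (K / (C * E))"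
  define G where "G = E * r / (2 * C) + D"
  have E: "E > 0"
    using discr by (simp add: E_def)
  have r: "r > 0" and q: "q > 0"
    using E assms(1-3) by (simp_all add: r_def q_def mult_neg_pos)
  have r_sq: "E * r\<^sup>2 = 4 * C * K"
    using E assms(1,2) by (simp add: r_def power_mult_distrib)
  have "C * K / E = C\<^sup>2 * (K / (C * E))"
    using \<open>C > 0\<close> E by (simp add: power2_eq_square field_simps)
  then have "r = 2 * (C * sqrt (K / (C * E)))"
    using \<open>C > 0\<close> by (simp only: r_def real_sqrt_mult) simp
  then have q_eq: "q + B * r / (2 * C) = 0"
    using \<open>C > 0\<close> by (simp add: q_def)
  have squares: "F (x, t) = C / t * (x + B * t / (2 * C))\<^sup>2 + E / (4 * C * t) * (t - r)\<^sup>2 + G"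
    if "x > 0" "t > 0" for x t :: real
    using cost_complete_squares[OF \<open>C > 0\<close> \<open>t > 0\<close> r_sq[unfolded E_def], of x D] F[OF that]
    by (simp add: E_def G_def)
  have F_opt: "F (q, r) = G"
    using squares[OF q r] q_eq by simp
  have "is_arg_min F (\<lambda>(x, t). x > 0 \<and> t > 0) z \<longleftrightarrow> z = (q, r)"
  proof (rule is_arg_min_iff_of_attained_bound)
    show "case (q, r) of (x, t) \<Rightarrow> x > 0 \<and> t > 0"
      using q r by simp
  next
    fix w :: "real \<times> real"
    assume "case w of (x, t) \<Rightarrow> x > 0 \<and> t > 0"
    then obtain x t where w: "w = (x, t)" "x > 0" "t > 0"
      by auto
    have nonneg: "C / t * (x + B * t / (2 * C))\<^sup>2 \<ge> 0" "E / (4 * C * t) * (t - r)\<^sup>2 \<ge> 0"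
      using \<open>C > 0\<close> E w by simp_all
    then show "F (q, r) \<le> F w"
      using squares[OF w(2,3)] by (simp add: F_opt w)
    assume "F w = F (q, r)"
    then have "C / t * (x + B * t / (2 * C))\<^sup>2 = 0" "E / (4 * C * t) * (t - r)\<^sup>2 = 0"
      using squares[OF w(2,3)] nonneg by (simp_all only: F_opt w(1))
    then have "x + B * t / (2 * C) = 0" "t = r"
      using \<open>C > 0\<close> E w by simp_all
    with q_eq show "w = (q, r)"
      by (simp add: w)
  qed
  then show ?thesis
    by (simp add: optimal_pair_def q_def r_def E_def)
qed

section \<open>The production system\<close>

theorem theorem1:
  fixes p lam p\<^sub>r \<theta> K c c\<^sub>d c\<^sub>p c\<^sub>s h\<^sub>s h\<^sub>r \<alpha> \<gamma> \<alpha>\<^sub>r \<eta> A B C D :: real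
    and TC :: "real \<times> real \<Rightarrow> real"
  assumes pos: "p > 0" "lam > 0" "p\<^sub>r > 0" "\<theta> > 0" "K > 0" "c > 0" "c\<^sub>d > 0" "c\<^sub>p > 0" "c\<^sub>s > 0"
      "h\<^sub>s > 0" "h\<^sub>r > 0"
    and alpha: "0 < \<alpha>" "\<alpha> < 1"
    and gamma: "0 < \<gamma>" "\<gamma> \<le> 1"
    and alpha_r: "0 < \<alpha>\<^sub>r" "\<alpha>\<^sub>r \<le> 1"
    and production: "\<alpha> * p > lam"
    and eta: "\<eta> = ((1 - \<alpha>) * lam) / (\<alpha> * p\<^sub>r + (1 - \<alpha>) * \<alpha>\<^sub>r * p\<^sub>r)"
    and A: "A =
        h\<^sub>s * (((\<alpha>\<^sub>r * p\<^sub>r - lam)^2 * \<eta>^2) / (2 * (\<alpha> * p - lam)) - ((\<alpha>\<^sub>r * p\<^sub>r - lam) * \<eta>^2) / 2)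
      + h\<^sub>r * (((p\<^sub>r^2 + (1 - \<alpha>) * p * p\<^sub>r) * \<eta>^2) / (2 * (1 - \<alpha>) * p))
      + c\<^sub>s * ((lam * ((1 - \<eta>) * (\<alpha> * p - lam) + \<eta> * (\<alpha>\<^sub>r * p\<^sub>r - lam))^2)
              / (2 * \<alpha> * p * (\<alpha> * p - lam)))"
    and B: "B =
        h\<^sub>s * (lam * \<eta> - ((\<alpha>\<^sub>r * p\<^sub>r - lam) * lam * \<eta>) / (\<alpha> * p - lam))
      - c\<^sub>s * ((lam * ((1 - \<eta>) * (\<alpha> * p - lam) + \<eta> * (\<alpha>\<^sub>r * p\<^sub>r - lam))) / (\<alpha> * p - lam))"
    and C: "C =
        (\<gamma> * c + (1 - \<gamma>) * c\<^sub>d) * ((lam * \<theta>) / 2)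
      + h\<^sub>s * (lam^2 / (2 * (\<alpha> * p - lam)) + lam / 2)
      + c\<^sub>s * ((\<alpha> * p * lam) / (2 * (\<alpha> * p - lam)))"
    and D: "D = c\<^sub>p * (1 - \<alpha>\<^sub>r) * p\<^sub>r * \<eta>"
    and TC: "\<And>T4 T. T4 > 0 \<Longrightarrow> T > 0 \<Longrightarrow>
        TC (T4, T) = A * T + B * T4 + C * (T4^2 / T) + K / T + D"
  shows "strictly_convex_on {(T4, T). T4 > 0 \<and> T > 0} TC \<and>
    (B < 0 \<and> 4 * A * C > B^2 \<longrightarrow>
      (\<exists>z. optimal_pair TC z) \<and>
      (\<forall>z. optimal_pair TC z \<longleftrightarrow>
        z = (- B * sqrt (K / (C * (4 * A * C - B^2))), 2 * sqrt (C * K / (4 * A * C - B^2)))))"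
proof -
  have gap: "\<alpha> * p - lam > 0"
    using production by simp
  have "(\<gamma> * c + (1 - \<gamma>) * c\<^sub>d) * (lam * \<theta> / 2) > 0"
    using pos gamma by (simp add: add_pos_nonneg)
  moreover have "h\<^sub>s * (lam\<^sup>2 / (2 * (\<alpha> * p - lam)) + lam / 2) > 0"
    using pos gap by (simp add: add_pos_pos)
  moreover have "c\<^sub>s * (\<alpha> * p * lam / (2 * (\<alpha> * p - lam))) > 0"
    using pos alpha gap by simp
  ultimately have "C > 0"
    unfolding C by linarith
  show ?thesis
  proof (intro conjI impI)
    show "strictly_convex_on {(T4, T). T4 > 0 \<and> T > 0} TC"
      using \<open>C > 0\<close> \<open>K > 0\<close> TC by (rule strictly_convex_on_positive_quadrant_cost)
  next
    assume "B < 0 \<and> 4 * A * C > B\<^sup>2"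
    then have "optimal_pair TC z \<longleftrightarrow>
        z = (- B * sqrt (K / (C * (4 * A * C - B\<^sup>2))), 2 * sqrt (C * K / (4 * A * C - B\<^sup>2)))" for z
      using \<open>C > 0\<close> \<open>K > 0\<close> TC by (intro optimal_pair_cost_iff) auto
    then show "\<exists>z. optimal_pair TC z"
      and "\<forall>z. optimal_pair TC z \<longleftrightarrow>
        z = (- B * sqrt (K / (C * (4 * A * C - B\<^sup>2))), 2 * sqrt (C * K / (4 * A * C - B\<^sup>2)))"
      by simp_all
  qed
qed

end
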